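(* Let $U_1,U_2,\ldots$ be independent and identically distributed real random variables with $\mathbb{E}(|U_i|^\nu)<\infty$ for some $\nu\ge 3$. Put $\mu_0=\mathbb{E}(U_i)$ and $\sigma^2=\mathbb{E}\{(U_i-\mu_0)^2\}>0$. Let $\ell(\mu)$ be the empirical likelihood ratio based on $U_1,\ldots,U_n$. If $\mu=\mu_n$ is a sequence of real numbers such that $|\mu-\mu_0|$ is exactly of order $n^{-w}$ for some $w\in(\frac1\nu,\frac12)$ (i.e. there are constants $0<a\le b<\infty$ with $a n^{-w}\le|\mu_n-\mu_0|\le b n^{-w}$ for all large $n$), then $$\frac{\ell(\mu)}{n(\mu-\mu_0)^2\sigma^{-2}}\xrightarrow{p}1\qquad\text{as } n\to\infty .$$
   Context: For real $\mu$, the empirical likelihood based on $U_1,\ldots,U_n$ is $$\mathrm{EL}(\mu)=\sup\Big\{\prod_{i=1}^n w_i:\ w_i\ge 0,\ \sum_{i=1}^n w_i=1,\ \sum_{i=1}^n w_i(U_i-\mu)=0\Big\}$$ (with $\sup\emptyset=0$), and the empirical likelihood ratio is $\ell(\mu)=-2\log\{\mathrm{EL}(\mu)\}-2n\log n$, with $\ell(\mu)=\infty$ if $\mu$ is not in the convex hull of $\{U_i\}_{i=1}^n$ (convention $\log 0=-\infty$). When $\mu$ is in the interior of the convex hull, $\ell(\mu)=2\sum_{i=1}^n\log\{1+\lambda(U_i-\mu)\}$, where the Lagrange multiplier $\lambda$ solves $0=\sum_{i=1}^n\frac{U_i-\mu}{1+\lambda(U_i-\mu)}$. The symbol $\xrightarrow{p}$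 denotes convergence in probability. *)

theory Defs
  imports "HOL-Probability.Probability"
begin

definition EL_products :: "nat \<Rightarrow> (nat \<Rightarrow> real) \<Rightarrow> real \<Rightarrow> real set" where
  "EL_products n u m =
     {\<Prod>i<n. w i | w. (\<forall>i<n. 0 \<le> w i) \<and> (\<Sum>i<n. w i) = 1 \<and> (\<Sum>i<n. w i * (u i - m)) = 0}"

text \<open>The real supremum of the empty set is unspecified, hence the case distinction.
  Otherwise the supremum is a genuine one, see \<open>bdd_above_EL_products\<close> below.\<close>

definition EL :: "nat \<Rightarrow> (nat \<Rightarrow> real) \<Rightarrow> real \<Rightarrow> real" where
  "EL n u m = (if EL_products n u m = {} then 0 else Sup (EL_products n u m))"

text \<open>Natural logarithm on \<open>[0, \<infinity>)\<close> with \<open>log 0 = -\<infinity>\<close>.\<close>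

definition elog :: "real \<Rightarrow> ereal" where
  "elog x = (if x \<le> 0 then -\<infinity> else ereal (ln x))"

text \<open>The value \<open>\<infinity>\<close> for \<open>m\<close> outside the convex hull of the sample is not
  a separate clause: it results from \<open>EL = 0\<close>, see \<open>EL_ratio_outside_hull\<close> below.\<close>

definition EL_ratio :: "nat \<Rightarrow> (nat \<Rightarrow> real) \<Rightarrow> real \<Rightarrow> ereal" where
  "EL_ratio n u m = ereal (-2) * elog (EL n u m) - ereal (2 * real n * ln (real n))"

text \<open>Convergence in probability of extended-real random variables to a real constant.
  Measurability is part of the notion; without it \<open>measure\<close> could be \<open>0\<close>
  merely because the event is not measurable.\<close>

definition tendsto_in_prob :: "'a measure \<Rightarrow> (nat \<Rightarrow> 'a \<Rightarrow> ereal) \<Rightarrow> real \<Rightarrow> bool" where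
  "tendsto_in_prob M X c \<longleftrightarrow>
     (\<forall>n. X n \<in> borel_measurable M) \<and>
     (\<forall>\<epsilon>>0. (\<lambda>n. measure M {\<omega> \<in> space M. \<bar>X n \<omega> - ereal c\<bar> > ereal \<epsilon>}) \<longlonglongrightarrow> 0)"

lemma bdd_above_EL_products: "bdd_above (EL_products n u m)"
proof (rule bdd_aboveI)
  fix x assume "x \<in> EL_products n u m"
  then obtain w where x: "x = (\<Prod>i<n. w i)" and w: "\<forall>i<n. 0 \<le> w i" "(\<Sum>i<n. w i) = 1"
    unfolding EL_products_def by blast
  have "w i \<le> 1" if "i < n" for i
    using member_le_sum[of i "{..<n}" w] that w by auto
  then show "x \<le> 1"
    unfolding x using w by (intro prod_le_1) auto
qed

lemma EL_ratio_outside_hull: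
  assumes "m \<notin> convex hull (u ` {..<n})"
  shows "EL_ratio n u m = \<infinity>"
proof -
  have "EL_products n u m = {}"
  proof (rule ccontr)
    assume "EL_products n u m \<noteq> {}"
    then obtain w where w: "\<forall>i<n. 0 \<le> w i" "(\<Sum>i<n. w i) = 1"
      and m: "(\<Sum>i<n. w i * (u i - m)) = 0"
      unfolding EL_products_def by blast
    have "(\<Sum>i<n. w i *\<^sub>R u i) \<in> convex hull (u ` {..<n})"
      using w by (intro convex_sum) (auto intro: hull_inc)
    moreover have "(\<Sum>i<n. w i *\<^sub>R u i) = m"
      using m w(2) by (simp add: right_diff_distrib sum_subtractf flip: sum_distrib_right)
    ultimately show False
      using assms by simp
  qed
  then show ?thesis
    by (simp add: EL_ratio_def EL_def elog_def)
qed

end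

theory Submission
  imports Defs
begin

text \<open>The empirical likelihood ratio at \<open>m\<close> is the infimum of \<open>-2 (\<Sum>i<n. ln (n * w i))\<close> over the weights
that move the mean of the sample \<open>u\<close> to \<open>m\<close>. It is trapped between two explicit quadratic expressions, which
avoids solving for the Lagrange multiplier. From above, the particular weights
\<open>w i = (1 + l * (u i - ub)) / n\<close>, tilted linearly around the sample mean \<open>ub\<close>, are feasible when
\<open>l = - (ub - m) / s\<close> with \<open>s\<close> the sample variance (\<open>EL_ratio_le_quadratic\<close>). From below, every real \<open>l\<close>
with all \<open>1 + l * (u i - m)\<close> positive gives the bound \<open>2 (\<Sum>i<n. ln (1 + l * (u i - m)))\<close>, by
\<open>ln y \<le> y - 1\<close>; the choice \<open>l = (ub - m) / q\<close>, with \<open>q\<close> the mean of the \<open>(u i - m)\<^sup>2\<close>, is close to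
optimal (\<open>EL_ratio_ge_quadratic\<close>). When all \<open>\<bar>l * (u i - m)\<bar>\<close> and \<open>\<bar>l * (u i - ub)\<bar>\<close> are small, the
quadratic expansion of the logarithm shows that both bounds are \<open>n * (ub - m)\<^sup>2 / \<sigma>2\<close> up to a factor
near \<open>1\<close>, provided that \<open>s\<close> and \<open>q\<close> are near \<open>\<sigma>2\<close> (\<open>EL_ratio_asymptotics\<close>).

The probabilistic input consists of three facts. As \<open>w < 1 / 2\<close>, Chebyshev's inequality shows that the
sample mean is within \<open>o(n powr -w)\<close> of \<open>\<mu>\<^sub>0\<close>, so that \<open>ub - \<mu> n\<close> is asymptotic to \<open>\<mu>\<^sub>0 - \<mu> n\<close>. As
\<open>w > 1 / \<nu>\<close>, Markov's inequality for the \<open>\<nu>\<close>-th moment and a union bound show that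
the largest \<open>\<bar>U i\<bar>\<close> with \<open>i < n\<close> is \<open>o(n powr w)\<close>. Multiplied by the multiplier, which is \<open>O(n powr -w)\<close>, this tends
to \<open>0\<close>; here the two conditions on the exponent meet. Finally the sample second moment converges, by
truncation at the level \<open>n powr w\<close>, so \<open>s\<close> and \<open>q\<close> tend to \<open>\<sigma>2\<close>.

To combine these facts, convergence in probability is expressed as ordinary convergence
along a filter on pairs of a sample size and an outcome. Sums, products, quotients and
comparisons of such limits then obey the usual rules.

Convergence in probability also asks for measurability of the ratio. A supremum over an uncountable set of weights that
depends on the sample is measurable because its superlevel sets are countable unions of closed sets,
each the projection of a closed set along a compact set of weights.\<close>

section \<open>Measurability of the empirical likelihood\<close>

lemma closed_projection_along_compact:
  fixes T :: "('a::topological_space \<times> 'b::topological_space) set"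
  assumes "compact K" "closed T"
  shows "closed {x. \<exists>y\<in>K. (x, y) \<in> T}"
proof -
  have "closed_map (prod_topology euclidean (top_of_set K)) euclidean (fst :: 'a \<times> 'b \<Rightarrow> 'a)"
    by (rule closed_map_fst) (simp add: assms(1) compact_space_subtopology)
  moreover have "prod_topology euclidean (top_of_set K) = top_of_set (UNIV \<times> K :: ('a \<times> 'b) set)"
    using prod_topology_subtopology(2)[of euclidean euclidean K]
    by (simp add: euclidean_product_topology)
  ultimately have "closed (fst ` (UNIV \<times> K \<inter> T))"
    using assms(2) unfolding closed_map_def by (auto simp: closedin_closed)
  also have "fst ` (UNIV \<times> K \<inter> T) = {x. \<exists>y\<in>K. (x, y) \<in> T}"
    by force
  finally show ?thesis .
qed

text \<open>The weights beyond index \<open>n\<close> do not enter the constraints. Setting them to \<open>0\<close> places all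
feasible weights in the cube \<open>[0, 1]\<close> to the power \<open>\<nat>\<close>, which is compact by Tychonoff's theorem. The closed set
of pairs (sample, weights) satisfying the constraints is projected along this cube.\<close>

lemma closed_EL_products_ge:
  "closed {u. \<exists>p\<in>EL_products n u m. c \<le> p}"
proof -
  define K :: "(nat \<Rightarrow> real) set" where "K = (\<Pi>\<^sub>E i\<in>UNIV. {0..1})"
  define T :: "((nat \<Rightarrow> real) \<times> (nat \<Rightarrow> real)) set" where
    "T = {x. (\<Sum>i<n. snd x i) = 1} \<inter> {x. (\<Sum>i<n. snd x i * (fst x i - m)) = 0}
         \<inter> {x. c \<le> (\<Prod>i<n. snd x i)}"
  have "compact K"
    using compactin_PiE[of "\<lambda>_::nat. euclidean :: real topology" UNIV "\<lambda>_. {0..1}"]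
    by (simp add: K_def euclidean_product_topology)
  have coord: "continuous_on A (\<lambda>x. fst x i)" "continuous_on A (\<lambda>x. snd x i)"
    for A :: "((nat \<Rightarrow> real) \<times> (nat \<Rightarrow> real)) set" and i
    by (rule continuous_on_product_then_coordinatewise, intro continuous_intros)+
  have "closed T"
    unfolding T_def
    by (intro closed_Int closed_Collect_eq closed_Collect_le continuous_intros coord)
  have "{u. \<exists>p\<in>EL_products n u m. c \<le> p} = {u. \<exists>w\<in>K. (u, w) \<in> T}"
  proof (intro Collect_cong iffI)
    fix u assume "\<exists>p\<in>EL_products n u m. c \<le> p"
    then obtain w where w: "\<And>i. i < n \<Longrightarrow> 0 \<le> w i" "(\<Sum>i<n. w i) = 1"
        "(\<Sum>i<n. w i * (u i - m)) = 0" "c \<le> (\<Prod>i<n. w i)"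
      unfolding EL_products_def by blast
    have "w i \<le> 1" if "i < n" for i
      using member_le_sum[of i "{..<n}" w] that w by auto
    then have "(\<lambda>i. if i < n then w i else 0) \<in> K"
      using w(1) by (auto simp: K_def)
    moreover have "(u, \<lambda>i. if i < n then w i else 0) \<in> T"
      using w(2-4) by (simp add: T_def cong: sum.cong_simp prod.cong_simp)
    ultimately show "\<exists>w\<in>K. (u, w) \<in> T" by blast
  next
    fix u assume "\<exists>w\<in>K. (u, w) \<in> T"
    then obtain w where "w \<in> K" "(u, w) \<in> T" by blast
    then show "\<exists>p\<in>EL_products n u m. c \<le> p"
      unfolding EL_products_def T_def K_def PiE_iff by (intro bexI[of _ "\<Prod>i<n. w i"]) auto
  qed
  then show ?thesis
    using closed_projection_along_compact[OF \<open>compact K\<close> \<open>closed T\<close>] by simp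
qed

lemma EL_nonneg: "0 \<le> EL n u m"
proof (cases "EL_products n u m = {}")
  case False
  then obtain p where p: "p \<in> EL_products n u m" by blast
  then have "0 \<le> p"
    unfolding EL_products_def by (auto intro!: prod_nonneg)
  also have "p \<le> Sup (EL_products n u m)"
    by (rule cSup_upper[OF p bdd_above_EL_products])
  finally show ?thesis using False by (simp add: EL_def)
qed (simp add: EL_def)

text \<open>A supremum exceeds \<open>c\<close> iff some element is at least \<open>c + 1 / (k + 1)\<close> for some \<open>k\<close>. This
turns the strict superlevel set into a countable union of the closed sets above.\<close>

lemma borel_measurable_EL: "(\<lambda>u. EL n u m) \<in> borel_measurable borel"
proof -
  have "{u. c < EL n u m} \<in> sets borel" for c
  proof (cases "c < 0")
    case True
    then have "{u. c < EL n u m} = UNIV"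
      using EL_nonneg[of n _ m] by (auto intro: less_le_trans)
    then show ?thesis by simp
  next
    case False
    have "c < EL n u m \<longleftrightarrow> (\<exists>k. \<exists>p\<in>EL_products n u m. c + inverse (real (Suc k)) \<le> p)" for u
    proof
      assume "c < EL n u m"
      then have "EL_products n u m \<noteq> {}" "c < Sup (EL_products n u m)"
        using False by (auto simp: EL_def split: if_splits)
      then obtain p where "p \<in> EL_products n u m" "c < p"
        using less_cSup_iff[OF _ bdd_above_EL_products] by blast
      moreover obtain k where "inverse (real (Suc k)) < p - c"
        using reals_Archimedean[of "p - c"] \<open>c < p\<close> by auto
      ultimately show "\<exists>k. \<exists>p\<in>EL_products n u m. c + inverse (real (Suc k)) \<le> p"
        by (intro exI[of _ k] bexI[of _ p]) auto
    next
      assume "\<exists>k. \<exists>p\<in>EL_products n u m. c + inverse (real (Suc k)) \<le> p"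
      then obtain k p where p: "p \<in> EL_products n u m" "c + inverse (real (Suc k)) \<le> p"
        by blast
      have "c < c + inverse (real (Suc k))" by simp
      also note p(2)
      also have "p \<le> EL n u m"
        using p(1) cSup_upper[OF p(1) bdd_above_EL_products] by (auto simp: EL_def)
      finally show "c < EL n u m" .
    qed
    then have "{u. c < EL n u m} =
        (\<Union>k. {u. \<exists>p\<in>EL_products n u m. c + inverse (real (Suc k)) \<le> p})"
      by blast
    also have "\<dots> \<in> sets borel"
      by (intro sets.countable_UN'' borel_closed closed_EL_products_ge) auto
    finally show ?thesis .
  qed
  then show ?thesis
    by (simp add: borel_measurable_iff_greater)
qed

text \<open>The sample enters as one measurable map into the product space \<open>nat \<Rightarrow> real\<close>, whose Borel sets
are generated by the coordinates.\<close>

lemma borel_measurable_EL_ratio: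
  assumes "\<And>i. U i \<in> borel_measurable M"
  shows "(\<lambda>\<omega>. EL_ratio n (\<lambda>i. U i \<omega>) m) \<in> borel_measurable M"
proof -
  have "(\<lambda>\<omega> i. U i \<omega>) \<in> borel_measurable M"
    using assms by (rule measurable_coordinatewise_then_product)
  from measurable_compose[OF this borel_measurable_EL]
  have [measurable]: "(\<lambda>\<omega>. EL n (\<lambda>i. U i \<omega>) m) \<in> borel_measurable M" .
  show ?thesis
    unfolding EL_ratio_def elog_def by measurable
qed

section \<open>Quadratic bounds on the empirical likelihood ratio\<close>

text \<open>The right side minus the left side vanishes at \<open>0\<close> and has the derivative
\<open>x * (1 / (1 - d) - 1 / (1 + x))\<close>, which vanishes or has the sign of \<open>x\<close> on \<open>[-d, d]\<close>. A lower bound for the logarithm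
suffices for both sides of the estimate of the ratio, since the dual bound contains \<open>ln\<close> with a positive and the
primal one with a negative sign.\<close>

lemma ln_one_plus_ge_quadratic:
  fixes t d :: real
  assumes "\<bar>t\<bar> \<le> d" "d < 1"
  shows "t - t\<^sup>2 / (2 * (1 - d)) \<le> ln (1 + t)"
proof -
  define k where "k = 1 / (2 * (1 - d))"
  define f where "f x = ln (1 + x) - x + k * x\<^sup>2" for x
  have der: "(f has_real_derivative x * (1 / (1 - d) - 1 / (1 + x))) (at x)" if "\<bar>x\<bar> \<le> d" for x
  proof -
    have pos: "1 + x > 0" "1 - d > 0" using that assms by auto
    have "(f has_real_derivative 1 / (1 + x) - 1 + k * (2 * x)) (at x)"
      unfolding f_def using pos by (auto intro!: derivative_eq_intros)
    also have "1 / (1 + x) - 1 + k * (2 * x) = x * (1 / (1 - d) - 1 / (1 + x))"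
      using pos by (simp add: k_def divide_simps) (simp add: algebra_simps)
    finally show ?thesis .
  qed
  have coeff: "1 / (1 - d) - 1 / (1 + x) \<ge> 0" if "\<bar>x\<bar> \<le> d" for x
    using that assms by (auto simp: frac_le)
  have "f 0 \<le> f t"
  proof (cases "0 \<le> t")
    case True
    show ?thesis
      by (rule DERIV_nonneg_imp_nondecreasing[OF True])
        (use assms der coeff in \<open>force intro!: mult_nonneg_nonneg\<close>)
  next
    case False
    show ?thesis
    proof (rule DERIV_nonpos_imp_nonincreasing[of t 0 f])
      fix x assume "t \<le> x" "x \<le> 0"
      then have "\<bar>x\<bar> \<le> d" using assms by auto
      then show "\<exists>y. (f has_real_derivative y) (at x) \<and> y \<le> 0"
        using der coeff \<open>x \<le> 0\<close>
        by (intro exI[of _ "x * (1 / (1 - d) - 1 / (1 + x))"] conjI mult_nonpos_nonneg) auto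
    qed (use False in auto)
  qed
  then show ?thesis by (simp add: f_def k_def)
qed

text \<open>The weights are normalised as \<open>v i = n * w i\<close>, which absorbs the term \<open>2 * n * ln n\<close> of the
ratio.\<close>

lemma EL_ratio_le_feasible:
  assumes "n > 0" "\<And>i. i < n \<Longrightarrow> 0 < v i" "(\<Sum>i<n. v i) = real n" "(\<Sum>i<n. v i * (u i - m)) = 0"
  shows "EL_ratio n u m \<le> ereal (- 2 * (\<Sum>i<n. ln (v i)))"
proof -
  define p where "p = (\<Prod>i<n. v i / n)"
  have "p \<in> EL_products n u m"
    unfolding EL_products_def p_def using assms
    by (intro CollectI exI[of _ "\<lambda>i. v i / n"])
      (auto simp: less_imp_le simp flip: sum_divide_distrib)
  then have "p \<le> EL n u m"
    using cSup_upper[OF _ bdd_above_EL_products] by (auto simp: EL_def)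
  moreover have "p > 0"
    unfolding p_def using assms by (intro prod_pos) auto
  moreover have "ln p = (\<Sum>i<n. ln (v i)) - n * ln n"
  proof -
    have "v i / n \<noteq> 0" if "i < n" for i
      using assms(1) assms(2)[OF that] by simp
    then have "ln p = (\<Sum>i<n. ln (v i / n))"
      unfolding p_def by (intro ln_prod) auto
    also have "\<dots> = (\<Sum>i<n. ln (v i) - ln n)"
      using assms(1,2) by (intro sum.cong ln_divide_pos) auto
    finally show ?thesis by (simp add: sum_subtractf)
  qed
  ultimately have "(\<Sum>i<n. ln (v i)) - n * ln n \<le> ln (EL n u m)" "EL n u m > 0"
    by (metis ln_mono order.strict_trans2, linarith)
  then show ?thesis
    by (auto simp: EL_ratio_def elog_def algebra_simps)
qed

text \<open>Weak Lagrangian duality: for feasible weights the numbers \<open>n * w i * (1 + l * (u i - m))\<close> have mean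
\<open>1\<close>, so the sum of their logarithms is at most \<open>0\<close>.\<close>

lemma EL_ratio_ge_dual:
  assumes "n > 0" "\<And>i. i < n \<Longrightarrow> 0 < 1 + l * (u i - m)"
  shows "ereal (2 * (\<Sum>i<n. ln (1 + l * (u i - m)))) \<le> EL_ratio n u m"
proof -
  define D where "D = (\<Sum>i<n. ln (1 + l * (u i - m)))"
  have bound: "p \<le> exp (- D - n * ln n)" if p_in: "p \<in> EL_products n u m" for p
  proof -
    obtain w where p: "p = (\<Prod>i<n. w i)" and w: "\<forall>i<n. 0 \<le> w i" "(\<Sum>i<n. w i) = 1"
      "(\<Sum>i<n. w i * (u i - m)) = 0"
      using p_in unfolding EL_products_def by blast
    show ?thesis
    proof (cases "\<exists>i<n. w i = 0")
      case True
      then have "p = 0" unfolding p by (auto simp: prod_zero_iff)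
      then show ?thesis by simp
    next
      case False
      then have pos: "w i > 0" if "i < n" for i using w(1) that by force
      have "ln p + n * ln n + D = (\<Sum>i<n. ln (n * w i * (1 + l * (u i - m))))"
      proof -
        have "ln p = (\<Sum>i<n. ln (w i))"
          unfolding p using False by (intro ln_prod) auto
        moreover have "ln (n * w i * (1 + l * (u i - m))) = ln (w i) + ln n + ln (1 + l * (u i - m))"
          if "i < n" for i
          using assms(1) assms(2)[OF that] pos[OF that] by (simp add: ln_mult_pos)
        ultimately show ?thesis by (simp add: D_def sum.distrib)
      qed
      also have "\<dots> \<le> (\<Sum>i<n. n * w i * (1 + l * (u i - m)) - 1)"
        using assms pos by (intro sum_mono ln_le_minus_one) auto
      also have "\<dots> = n * (\<Sum>i<n. w i) + n * l * (\<Sum>i<n. w i * (u i - m)) - n"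
        by (simp add: sum_subtractf sum_distrib_left algebra_simps sum.distrib)
      also have "\<dots> = 0" using w by simp
      finally have "ln p \<le> - D - n * ln n" by simp
      moreover have "p > 0" unfolding p using pos by (intro prod_pos) auto
      ultimately show ?thesis by (metis exp_le_cancel_iff exp_ln)
    qed
  qed
  have "EL n u m \<le> exp (- D - n * ln n)"
    using bound by (auto simp: EL_def intro!: cSup_least)
  then have "ln (EL n u m) \<le> - D - n * ln n" if "EL n u m > 0"
    using that by (metis exp_le_cancel_iff exp_ln)
  then show ?thesis
    unfolding D_def[symmetric] by (auto simp: EL_ratio_def elog_def)
qed

text \<open>The multiplier \<open>l = xb / q\<close> maximises the quadratic approximation
\<open>2 * n * (l * xb - l\<^sup>2 * q / 2)\<close> of the dual objective. The factor \<open>2 - 1 / (1 - d)\<close>, which tends to \<open>1\<close> as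
\<open>d\<close> tends to \<open>0\<close>, accounts for the error of the approximation.\<close>

lemma EL_ratio_ge_quadratic:
  fixes u :: "nat \<Rightarrow> real" and n :: nat and m xb q :: real
  defines "xb \<equiv> (\<Sum>i<n. u i - m) / n" and "q \<equiv> (\<Sum>i<n. (u i - m)\<^sup>2) / n"
  assumes "n > 0" "q > 0" "d < 1" and small: "\<And>i. i < n \<Longrightarrow> \<bar>xb * (u i - m)\<bar> \<le> d * q"
  shows "ereal (n * xb\<^sup>2 / q * (2 - 1 / (1 - d))) \<le> EL_ratio n u m"
proof -
  define l where "l = xb / q"
  have lx: "\<bar>l * (u i - m)\<bar> \<le> d" if "i < n" for i
    using small[OF that] \<open>q > 0\<close> by (simp add: l_def abs_mult field_simps)
  have sums: "(\<Sum>i<n. u i - m) = n * xb" "(\<Sum>i<n. (u i - m)\<^sup>2) = n * q"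
    using \<open>n > 0\<close> by (simp_all add: xb_def q_def)
  have "n * xb\<^sup>2 / q * (2 - 1 / (1 - d)) = 2 * (l * (n * xb) - l\<^sup>2 * (n * q) / (2 * (1 - d)))"
    using \<open>q > 0\<close> \<open>d < 1\<close> by (simp add: l_def divide_simps) (simp add: algebra_simps power2_eq_square)
  also have "\<dots> = 2 * (\<Sum>i<n. l * (u i - m) - (l * (u i - m))\<^sup>2 / (2 * (1 - d)))"
    by (simp add: sum_subtractf power_mult_distrib flip: sums sum_distrib_left sum_divide_distrib)
  also have "\<dots> \<le> 2 * (\<Sum>i<n. ln (1 + l * (u i - m)))"
    using lx \<open>d < 1\<close> by (intro mult_left_mono sum_mono ln_one_plus_ge_quadratic) auto
  also have "ereal \<dots> \<le> EL_ratio n u m"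
    using lx \<open>d < 1\<close> \<open>n > 0\<close> by (intro EL_ratio_ge_dual) fastforce+
  finally show ?thesis by simp
qed

text \<open>The linear tilt of the uniform weights around the sample mean keeps their sum, and its slope is
chosen so that the tilted mean is \<open>m\<close>. As the deviations \<open>u i - ub\<close> sum to \<open>0\<close>, the first-order
term of the logarithms cancels and only the quadratic one contributes.\<close>

lemma EL_ratio_le_quadratic:
  fixes u :: "nat \<Rightarrow> real" and n :: nat and m ub s :: real
  defines "ub \<equiv> (\<Sum>i<n. u i) / n"
    and "s \<equiv> (\<Sum>i<n. (u i)\<^sup>2) / n - ((\<Sum>i<n. u i) / n)\<^sup>2"
  assumes "n > 0" "s > 0" "d < 1" and small: "\<And>i. i < n \<Longrightarrow> \<bar>(ub - m) * (u i - ub)\<bar> \<le> d * s"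
  shows "EL_ratio n u m \<le> ereal (n * (ub - m)\<^sup>2 / s / (1 - d))"
proof -
  define l where "l = - (ub - m) / s"
  define v where "v i = 1 + l * (u i - ub)" for i
  have lx: "\<bar>l * (u i - ub)\<bar> \<le> d" if "i < n" for i
    using small[OF that] \<open>s > 0\<close> by (simp add: l_def abs_mult field_simps)
  have sums: "(\<Sum>i<n. u i) = n * ub" "(\<Sum>i<n. (u i)\<^sup>2) = n * (s + ub\<^sup>2)"
    using \<open>n > 0\<close> by (simp_all add: ub_def s_def)
  have centred: "(\<Sum>i<n. u i - ub) = 0"
    using sums by (simp add: sum_subtractf)
  have sq: "(\<Sum>i<n. (u i - ub)\<^sup>2) = n * s"
    using sums by (simp add: power2_diff sum_subtractf sum.distrib algebra_simps power2_eq_square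
        flip: sum_distrib_left sum_distrib_right)
  have "EL_ratio n u m \<le> ereal (- 2 * (\<Sum>i<n. ln (v i)))"
  proof (rule EL_ratio_le_feasible[OF \<open>n > 0\<close>])
    show "0 < v i" if "i < n" for i
      using lx[OF that] \<open>d < 1\<close> by (auto simp: v_def)
    show "(\<Sum>i<n. v i) = n"
      using centred by (simp add: v_def sum.distrib flip: sum_distrib_left)
    have "(\<Sum>i<n. v i * (u i - m)) = (\<Sum>i<n. (ub - m) + (1 + l * (ub - m)) * (u i - ub) + l * (u i - ub)\<^sup>2)"
      by (intro sum.cong) (auto simp: v_def algebra_simps power2_eq_square)
    also have "\<dots> = n * (ub - m) + l * (n * s)"
      using centred sq by (simp add: sum.distrib flip: sum_distrib_left)
    also have "\<dots> = 0"
      using \<open>s > 0\<close> by (simp add: l_def) (simp add: algebra_simps)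
    finally show "(\<Sum>i<n. v i * (u i - m)) = 0" .
  qed
  also have "- 2 * (\<Sum>i<n. ln (v i)) \<le> - 2 * (\<Sum>i<n. l * (u i - ub) - (l * (u i - ub))\<^sup>2 / (2 * (1 - d)))"
    unfolding v_def using lx \<open>d < 1\<close>
    by (intro mult_left_mono_neg sum_mono ln_one_plus_ge_quadratic) auto
  also have "(\<Sum>i<n. l * (u i - ub) - (l * (u i - ub))\<^sup>2 / (2 * (1 - d)))
      = l * (\<Sum>i<n. u i - ub) - l\<^sup>2 * (\<Sum>i<n. (u i - ub)\<^sup>2) / (2 * (1 - d))"
    by (subst sum_subtractf) (simp only: power_mult_distrib sum_distrib_left sum_divide_distrib)
  also have "- 2 * \<dots> = l\<^sup>2 * (n * s) / (1 - d)"
    using \<open>d < 1\<close> by (simp add: centred sq field_simps)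
  also have "l\<^sup>2 * (n * s) = n * (ub - m)\<^sup>2 / s"
    using \<open>s > 0\<close> by (simp add: l_def power_divide power2_commute[of m]) (simp add: power2_eq_square)
  finally show ?thesis by simp
qed

section \<open>Convergence in probability as convergence along a filter\<close>

text \<open>A property of a sample size \<open>n\<close> and an outcome holds eventually along this filter
iff it holds outside exceptional events whose probabilities tend to \<open>0\<close> as \<open>n\<close> grows. Measurability is
required of the exceptional events \<open>B n\<close> only, so that the filter is closed under weakening of \<open>P\<close>.\<close>

definition off_vanishing_events :: "'a measure \<Rightarrow> (nat \<times> 'a) filter" where
  "off_vanishing_events M = Abs_filter (\<lambda>P. \<exists>B. (\<forall>n. B n \<in> sets M) \<and>
     (\<lambda>n. measure M (B n)) \<longlonglongrightarrow> 0 \<and> (\<forall>n. \<forall>\<omega>\<in>space M - B n. P (n, \<omega>)))"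

context prob_space
begin

lemma eventually_off_vanishing_events:
  "eventually P (off_vanishing_events M) \<longleftrightarrow> (\<exists>B. (\<forall>n. B n \<in> events) \<and>
     (\<lambda>n. prob (B n)) \<longlonglongrightarrow> 0 \<and> (\<forall>n. \<forall>\<omega>\<in>space M - B n. P (n, \<omega>)))"
  unfolding off_vanishing_events_def
proof (rule eventually_Abs_filter, rule is_filter.intro, goal_cases)
  case 1
  show ?case by (intro exI[of _ "\<lambda>_. {}"]) auto
next
  case (2 P Q)
  then obtain B C where B: "\<forall>n. B n \<in> events" "(\<lambda>n. prob (B n)) \<longlonglongrightarrow> 0" "\<forall>n. \<forall>\<omega>\<in>space M - B n. P (n, \<omega>)"
    and C: "\<forall>n. C n \<in> events" "(\<lambda>n. prob (C n)) \<longlonglongrightarrow> 0" "\<forall>n. \<forall>\<omega>\<in>space M - C n. Q (n, \<omega>)"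
    by blast
  have "(\<lambda>n. prob (B n \<union> C n)) \<longlonglongrightarrow> 0"
  proof (rule tendsto_sandwich[of "\<lambda>_. 0"])
    show "\<forall>\<^sub>F n in sequentially. prob (B n \<union> C n) \<le> prob (B n) + prob (C n)"
      using B(1) C(1) by (intro always_eventually) (auto intro: measure_Un_le)
    show "(\<lambda>n. prob (B n) + prob (C n)) \<longlonglongrightarrow> 0"
      using tendsto_add[OF B(2) C(2)] by simp
  qed auto
  then show ?case
    using B C by (intro exI[of _ "\<lambda>n. B n \<union> C n"]) auto
next
  case (3 P Q)
  then show ?case by meson
qed

lemma eventually_fst_off_vanishing_events:
  assumes "\<forall>\<^sub>F n in sequentially. P n"
  shows "\<forall>\<^sub>F x in off_vanishing_events M. P (fst x)"
proof -
  have "(\<lambda>n. prob (if P n then {} else space M)) \<longlonglongrightarrow> 0"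
    by (rule tendsto_eventually, rule eventually_mono[OF assms]) simp
  then show ?thesis
    unfolding eventually_off_vanishing_events
    by (intro exI[of _ "\<lambda>n. if P n then {} else space M"]) auto
qed

lemma tendsto_fst_off_vanishing_events:
  assumes "f \<longlonglongrightarrow> c"
  shows "((\<lambda>x. f (fst x)) \<longlongrightarrow> c) (off_vanishing_events M)"
  using assms unfolding tendsto_def by (auto intro: eventually_fst_off_vanishing_events)

text \<open>As \<open>c\<close> is finite, an outcome off the exceptional event has a finite value of \<open>X n\<close> at distance
at most \<open>\<epsilon>\<close> from \<open>c\<close>; so the probability in question is at most that of the exceptional event.\<close>

lemma tendsto_in_prob_if_tendsto_off_vanishing_events:
  assumes meas: "\<And>n. X n \<in> borel_measurable M"
    and lim: "((\<lambda>x. X (fst x) (snd x)) \<longlongrightarrow> ereal c) (off_vanishing_events M)"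
  shows "tendsto_in_prob M X c"
  unfolding tendsto_in_prob_def
proof (intro conjI allI impI meas)
  fix e :: real assume "e > 0"
  have "\<forall>\<^sub>F x in off_vanishing_events M. \<bar>X (fst x) (snd x) - ereal c\<bar> \<le> ereal e"
  proof -
    have "\<forall>\<^sub>F x in off_vanishing_events M. ereal (c - e) < X (fst x) (snd x)"
      and "\<forall>\<^sub>F x in off_vanishing_events M. X (fst x) (snd x) < ereal (c + e)"
      using \<open>e > 0\<close> by (auto intro!: order_tendstoD[OF lim])
    then show ?thesis
    proof eventually_elim
      case (elim x)
      then show ?case by (cases "X (fst x) (snd x)") auto
    qed
  qed
  then obtain B where B: "\<forall>n. B n \<in> events" "(\<lambda>n. prob (B n)) \<longlonglongrightarrow> 0"
    "\<forall>n. \<forall>\<omega>\<in>space M - B n. \<bar>X n \<omega> - ereal c\<bar> \<le> ereal e"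
    unfolding eventually_off_vanishing_events by auto
  have "prob {\<omega> \<in> space M. \<bar>X n \<omega> - ereal c\<bar> > ereal e} \<le> prob (B n)" for n
    using B(1,3) by (intro finite_measure_mono) force+
  then show "(\<lambda>n. prob {\<omega> \<in> space M. \<bar>X n \<omega> - ereal c\<bar> > ereal e}) \<longlonglongrightarrow> 0"
    by (intro tendsto_sandwich[OF _ _ tendsto_const B(2)] always_eventually) auto
qed

text \<open>By Chebyshev's inequality the exceptional events \<open>e \<le> \<bar>X n\<bar>\<close> have probability at most the second
moment divided by \<open>e\<^sup>2\<close>.\<close>

lemma tendsto_off_vanishing_events_if_second_moment:
  fixes X :: "nat \<Rightarrow> 'a \<Rightarrow> real"
  assumes [measurable]: "\<And>n. X n \<in> borel_measurable M"
    and int: "\<And>n. integrable M (\<lambda>\<omega>. (X n \<omega>)\<^sup>2)"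
    and lim: "(\<lambda>n. expectation (\<lambda>\<omega>. (X n \<omega>)\<^sup>2)) \<longlonglongrightarrow> 0"
  shows "((\<lambda>x. X (fst x) (snd x)) \<longlongrightarrow> 0) (off_vanishing_events M)"
proof (rule tendstoI)
  fix e :: real assume "e > 0"
  let ?B = "\<lambda>n. {\<omega> \<in> space M. e \<le> \<bar>X n \<omega>\<bar>}"
  have "(\<lambda>n. prob (?B n)) \<longlonglongrightarrow> 0"
  proof (rule tendsto_sandwich[of "\<lambda>_. 0"])
    show "\<forall>\<^sub>F n in sequentially. prob (?B n) \<le> expectation (\<lambda>\<omega>. (X n \<omega>)\<^sup>2) / e\<^sup>2"
      using \<open>e > 0\<close> int by (intro always_eventually allI second_moment_method) auto
    show "(\<lambda>n. expectation (\<lambda>\<omega>. (X n \<omega>)\<^sup>2) / e\<^sup>2) \<longlonglongrightarrow> 0"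
      using tendsto_divide[OF lim tendsto_const, of "e\<^sup>2"] \<open>e > 0\<close> by simp
  qed auto
  then show "\<forall>\<^sub>F x in off_vanishing_events M. dist (X (fst x) (snd x)) 0 < e"
    unfolding eventually_off_vanishing_events
    by (intro exI[of _ ?B]) auto
qed

section \<open>Sample moments and the sample maximum\<close>

text \<open>The cross terms vanish, since \<open>X n\<close> is independent of the sum of its predecessors.\<close>

lemma expectation_square_sum_indep_centred:
  fixes X :: "nat \<Rightarrow> 'a \<Rightarrow> real"
  assumes ind: "indep_vars (\<lambda>_. borel) X UNIV"
    and int2: "\<And>i. integrable M (\<lambda>\<omega>. (X i \<omega>)\<^sup>2)"
    and centred: "\<And>i. expectation (X i) = 0"
  shows "integrable M (\<lambda>\<omega>. (\<Sum>i<n. X i \<omega>)\<^sup>2)"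
    and "expectation (\<lambda>\<omega>. (\<Sum>i<n. X i \<omega>)\<^sup>2) = (\<Sum>i<n. expectation (\<lambda>\<omega>. (X i \<omega>)\<^sup>2))"
proof -
  have [measurable]: "X i \<in> borel_measurable M" for i
    using ind by (auto simp: indep_vars_def)
  have int: "integrable M (X i)" for i
    using int2[of i] by (rule square_integrable_imp_integrable[rotated]) simp
  have "integrable M (\<lambda>\<omega>. (\<Sum>i<n. X i \<omega>)\<^sup>2) \<and>
    expectation (\<lambda>\<omega>. (\<Sum>i<n. X i \<omega>)\<^sup>2) = (\<Sum>i<n. expectation (\<lambda>\<omega>. (X i \<omega>)\<^sup>2))"
  proof (induction n)
    case (Suc n)
    let ?S = "\<lambda>\<omega>. \<Sum>i<n. X i \<omega>"
    have iv: "indep_var borel (X n) borel ?S"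
      by (rule indep_vars_sum) (auto intro: indep_vars_subset[OF ind])
    have intS: "integrable M ?S" using int by auto
    have cross: "integrable M (\<lambda>\<omega>. X n \<omega> * ?S \<omega>)" "expectation (\<lambda>\<omega>. X n \<omega> * ?S \<omega>) = 0"
      using indep_var_integrable[OF iv int intS] indep_var_lebesgue_integral[OF iv int intS] centred by simp_all
    have expand: "(\<Sum>i<Suc n. X i \<omega>)\<^sup>2 = (?S \<omega>)\<^sup>2 + 2 * (X n \<omega> * ?S \<omega>) + (X n \<omega>)\<^sup>2" for \<omega>
      by (simp add: power2_sum algebra_simps)
    show ?case
      unfolding expand using Suc.IH cross int2[of n] by simp
  qed simp
  then show "integrable M (\<lambda>\<omega>. (\<Sum>i<n. X i \<omega>)\<^sup>2)"
    and "expectation (\<lambda>\<omega>. (\<Sum>i<n. X i \<omega>)\<^sup>2) = (\<Sum>i<n. expectation (\<lambda>\<omega>. (X i \<omega>)\<^sup>2))" by auto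
qed

lemma sample_mean_second_moment:
  fixes X :: "nat \<Rightarrow> 'a \<Rightarrow> real"
  assumes ind: "indep_vars (\<lambda>_. borel) X UNIV"
    and int2: "\<And>i. integrable M (\<lambda>\<omega>. (X i \<omega>)\<^sup>2)"
    and mean: "\<And>i. expectation (X i) = m"
    and bound: "\<And>i. expectation (\<lambda>\<omega>. (X i \<omega>)\<^sup>2) \<le> s"
    and "n > 0"
  shows "integrable M (\<lambda>\<omega>. ((\<Sum>i<n. X i \<omega>) / n - m)\<^sup>2)"
    and "expectation (\<lambda>\<omega>. ((\<Sum>i<n. X i \<omega>) / n - m)\<^sup>2) \<le> s / n"
proof -
  have meas[measurable]: "X i \<in> borel_measurable M" for i
    using ind by (auto simp: indep_vars_def)
  have int: "integrable M (X i)" for i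
    using int2[of i] by (rule square_integrable_imp_integrable[rotated]) simp
  define Y where "Y i \<omega> = X i \<omega> - m" for i \<omega>
  have indY: "indep_vars (\<lambda>_. borel) Y UNIV"
    using indep_vars_compose2[OF ind, of "\<lambda>_ x. x - m" "\<lambda>_. borel"] by (simp add: Y_def[abs_def])
  have Y2: "(Y i \<omega>)\<^sup>2 = (X i \<omega>)\<^sup>2 - 2 * m * X i \<omega> + m\<^sup>2" for i \<omega>
    by (simp add: Y_def power2_diff algebra_simps)
  have intY2: "integrable M (\<lambda>\<omega>. (Y i \<omega>)\<^sup>2)" for i
    unfolding Y2 using int int2 by simp
  have EY: "expectation (Y i) = 0" for i
    unfolding Y_def[abs_def] using int by (simp add: mean prob_space)
  have EY2: "expectation (\<lambda>\<omega>. (Y i \<omega>)\<^sup>2) \<le> s" for i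
  proof -
    have "expectation (\<lambda>\<omega>. (Y i \<omega>)\<^sup>2) = expectation (\<lambda>\<omega>. (X i \<omega>)\<^sup>2) - m\<^sup>2"
      unfolding Y2 using int int2 by (simp add: mean prob_space power2_eq_square)
    also have "\<dots> \<le> s" using bound[of i] zero_le_power2[of m] by linarith
    finally show ?thesis .
  qed
  have eq: "((\<Sum>i<n. X i \<omega>) / n - m)\<^sup>2 = (\<Sum>i<n. Y i \<omega>)\<^sup>2 / (real n)\<^sup>2" for \<omega>
    using \<open>n > 0\<close> by (simp add: Y_def sum_subtractf diff_divide_distrib flip: power_divide)
  note sq = expectation_square_sum_indep_centred[OF indY intY2 EY, of n]
  show "integrable M (\<lambda>\<omega>. ((\<Sum>i<n. X i \<omega>) / n - m)\<^sup>2)"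
    unfolding eq using sq(1) by simp
  have "expectation (\<lambda>\<omega>. ((\<Sum>i<n. X i \<omega>) / n - m)\<^sup>2) = (\<Sum>i<n. expectation (\<lambda>\<omega>. (Y i \<omega>)\<^sup>2)) / (real n)\<^sup>2"
    unfolding eq by (simp add: sq(2))
  also have "\<dots> \<le> (n * s) / (real n)\<^sup>2"
    using sum_mono[of "{..<n}" "\<lambda>i. expectation (\<lambda>\<omega>. (Y i \<omega>)\<^sup>2)" "\<lambda>_. s"] EY2
    by (intro divide_right_mono) auto
  also have "\<dots> = s / n" using \<open>n > 0\<close> by (simp add: power2_eq_square)
  finally show "expectation (\<lambda>\<omega>. ((\<Sum>i<n. X i \<omega>) / n - m)\<^sup>2) \<le> s / n" .
qed

text \<open>By Markov's inequality and a union bound the exceptional event has probability at most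
\<open>n * c / (\<eta> * n powr w) powr \<nu>\<close>, of order \<open>n powr (1 - w * \<nu>)\<close>, which tends to \<open>0\<close> because \<open>w > 1 / \<nu>\<close>.\<close>

lemma sample_abs_le_power_off_vanishing_events:
  fixes U :: "nat \<Rightarrow> 'a \<Rightarrow> real"
  assumes [measurable]: "\<And>i. U i \<in> borel_measurable M"
    and int: "\<And>i. integrable M (\<lambda>\<omega>. \<bar>U i \<omega>\<bar> powr \<nu>)"
    and moment: "\<And>i. expectation (\<lambda>\<omega>. \<bar>U i \<omega>\<bar> powr \<nu>) = c"
    and "\<nu> > 0" "1 / \<nu> < w" "\<eta> > 0"
  shows "\<forall>\<^sub>F x in off_vanishing_events M. \<forall>i<fst x. \<bar>U i (snd x)\<bar> \<le> \<eta> * real (fst x) powr w"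
proof -
  let ?B = "\<lambda>n. \<Union>i<n. {\<omega> \<in> space M. \<eta> * real n powr w < \<bar>U i \<omega>\<bar>}"
  have bound: "prob (?B n) \<le> c / \<eta> powr \<nu> * real n powr (1 - w * \<nu>)" if "n > 0" for n
  proof -
    define t where "t = \<eta> * real n powr w"
    have "t > 0" using that \<open>\<eta> > 0\<close> by (simp add: t_def)
    have "prob (?B n) \<le> (\<Sum>i<n. prob {\<omega> \<in> space M. t < \<bar>U i \<omega>\<bar>})"
      unfolding t_def by (rule finite_measure_subadditive_finite) auto
    also have "\<dots> \<le> (\<Sum>i<n. c / t powr \<nu>)"
    proof (rule sum_mono)
      fix i
      have "prob {\<omega> \<in> space M. t < \<bar>U i \<omega>\<bar>} \<le> prob {\<omega> \<in> space M. t powr \<nu> \<le> \<bar>U i \<omega>\<bar> powr \<nu>}"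
        using \<open>t > 0\<close> \<open>\<nu> > 0\<close> by (intro finite_measure_mono) (auto intro!: powr_mono2)
      also have "\<dots> \<le> c / t powr \<nu>"
        unfolding moment[of i, symmetric] using \<open>t > 0\<close> int
        by (intro integral_Markov_inequality_measure[of _ _ "space M"]) auto
      finally show "prob {\<omega> \<in> space M. t < \<bar>U i \<omega>\<bar>} \<le> c / t powr \<nu>" .
    qed
    also have "\<dots> = c / \<eta> powr \<nu> * real n powr (1 - w * \<nu>)"
      using that \<open>\<eta> > 0\<close> by (simp add: t_def powr_mult powr_powr powr_diff)
    finally show ?thesis .
  qed
  have "(\<lambda>n. prob (?B n)) \<longlonglongrightarrow> 0"
  proof (rule tendsto_sandwich[of "\<lambda>_. 0"])
    show "\<forall>\<^sub>F n in sequentially. prob (?B n) \<le> c / \<eta> powr \<nu> * real n powr (1 - w * \<nu>)"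
      using eventually_gt_at_top[of 0] by eventually_elim (rule bound)
    have "1 - w * \<nu> < 0" using \<open>\<nu> > 0\<close> \<open>1 / \<nu> < w\<close> by (simp add: field_simps)
    then have "(\<lambda>n. real n powr (1 - w * \<nu>)) \<longlonglongrightarrow> 0"
      by (intro tendsto_neg_powr filterlim_real_sequentially)
    then show "(\<lambda>n. c / \<eta> powr \<nu> * real n powr (1 - w * \<nu>)) \<longlonglongrightarrow> 0"
      by (rule tendsto_mult_right_zero)
  qed auto
  then show ?thesis
    unfolding eventually_off_vanishing_events by (intro exI[of _ ?B]) (auto simp: not_less)
qed

text \<open>The mean square of the scaled deviation is at most \<open>s * n powr (2 * w - 1)\<close>, which tends to
\<open>0\<close> because \<open>w < 1 / 2\<close>.\<close>

lemma sample_mean_rate_off_vanishing_events: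
  fixes U :: "nat \<Rightarrow> 'a \<Rightarrow> real"
  assumes ind: "indep_vars (\<lambda>_. borel) U UNIV"
    and int2: "\<And>i. integrable M (\<lambda>\<omega>. (U i \<omega>)\<^sup>2)"
    and mean: "\<And>i. expectation (U i) = m"
    and second: "\<And>i. expectation (\<lambda>\<omega>. (U i \<omega>)\<^sup>2) = s"
    and "w < 1 / 2"
  shows "((\<lambda>x. real (fst x) powr w * ((\<Sum>i<fst x. U i (snd x)) / fst x - m)) \<longlongrightarrow> 0)
    (off_vanishing_events M)"
proof -
  define X where "X n \<omega> = real n powr w * ((\<Sum>i<n. U i \<omega>) / n - m)" for n \<omega>
  have meas[measurable]: "U i \<in> borel_measurable M" for i
    using ind by (auto simp: indep_vars_def)
  have X2: "(X n \<omega>)\<^sup>2 = real n powr (2 * w) * ((\<Sum>i<n. U i \<omega>) / n - m)\<^sup>2" for n \<omega>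
    by (simp add: X_def power_mult_distrib power2_eq_square[of "real n powr w"] flip: powr_add)
  note sm = sample_mean_second_moment[OF ind int2 mean eq_refl[OF second]]
  have int: "integrable M (\<lambda>\<omega>. (X n \<omega>)\<^sup>2)" for n
  proof (cases "n = 0")
    case False
    then show ?thesis unfolding X2 using sm(1)[of n] by simp
  qed (simp add: X_def)
  have "(\<lambda>n. expectation (\<lambda>\<omega>. (X n \<omega>)\<^sup>2)) \<longlonglongrightarrow> 0"
  proof (rule tendsto_sandwich[of "\<lambda>_. 0"])
    show "\<forall>\<^sub>F n in sequentially. expectation (\<lambda>\<omega>. (X n \<omega>)\<^sup>2) \<le> s * real n powr (2 * w - 1)"
      using eventually_gt_at_top[of 0]
    proof eventually_elim
      case (elim n)
      have "expectation (\<lambda>\<omega>. (X n \<omega>)\<^sup>2) \<le> real n powr (2 * w) * (s / n)"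
        unfolding X2 using sm[OF elim] by (simp add: mult_left_mono del: times_divide_eq_right)
      also have "\<dots> = s * real n powr (2 * w - 1)"
        using elim by (simp add: powr_diff)
      finally show ?case .
    qed
    have "(\<lambda>n. real n powr (2 * w - 1)) \<longlonglongrightarrow> 0"
      using \<open>w < 1 / 2\<close> by (intro tendsto_neg_powr filterlim_real_sequentially) auto
    then show "(\<lambda>n. s * real n powr (2 * w - 1)) \<longlonglongrightarrow> 0"
      by (rule tendsto_mult_right_zero)
  qed auto
  then have "((\<lambda>x. X (fst x) (snd x)) \<longlongrightarrow> 0) (off_vanishing_events M)"
    using int by (intro tendsto_off_vanishing_events_if_second_moment) (auto simp: X_def[abs_def])
  then show ?thesis by (simp add: X_def)
qed

text \<open>The squares \<open>(U i)\<^sup>2\<close> need not have a finite variance, so Chebyshev's inequality does not apply to them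
directly. They are cut off at \<open>n powr (2 * w)\<close>. This changes nothing off vanishing events, and it
changes the expectation by a null sequence, by dominated convergence. The second moment of the truncated
square is at most \<open>n powr (2 * w) * s\<close>, which is \<open>o(n)\<close>.\<close>

lemma sample_second_moment_off_vanishing_events:
  fixes U :: "nat \<Rightarrow> 'a \<Rightarrow> real"
  assumes ind: "indep_vars (\<lambda>_. borel) U UNIV"
    and ident: "\<And>i j. distr M borel (U i) = distr M borel (U j)"
    and int2: "\<And>i. integrable M (\<lambda>\<omega>. (U i \<omega>)\<^sup>2)"
    and max: "\<forall>\<^sub>F x in off_vanishing_events M. \<forall>i<fst x. \<bar>U i (snd x)\<bar> \<le> real (fst x) powr w"
    and "0 < w" "w < 1 / 2"
  shows "((\<lambda>x. (\<Sum>i<fst x. (U i (snd x))\<^sup>2) / fst x) \<longlongrightarrow> expectation (\<lambda>\<omega>. (U 0 \<omega>)\<^sup>2))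
    (off_vanishing_events M)"
proof -
  have meas[measurable]: "U i \<in> borel_measurable M" for i
    using ind by (auto simp: indep_vars_def)
  define tr where "tr n y = min (y\<^sup>2) ((real n powr w)\<^sup>2)" for n and y :: real
  have [measurable]: "tr n \<in> borel_measurable borel" for n
    by (simp add: tr_def[abs_def])
  have same: "expectation (\<lambda>\<omega>. g (U i \<omega>)) = expectation (\<lambda>\<omega>. g (U 0 \<omega>))"
    if [measurable]: "g \<in> borel_measurable borel" for g :: "real \<Rightarrow> real" and i
    using ident[of i 0] by (simp flip: integral_distr[OF meas that])
  define s where "s = expectation (\<lambda>\<omega>. (U 0 \<omega>)\<^sup>2)"
  define e where "e n = expectation (\<lambda>\<omega>. tr n (U 0 \<omega>))" for n
  have tr_bounds: "0 \<le> tr n y" "tr n y \<le> y\<^sup>2" "tr n y \<le> (real n powr w)\<^sup>2" for n y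
    by (auto simp: tr_def)
  have tr_sq: "(tr n y)\<^sup>2 \<le> (real n powr w)\<^sup>2 * y\<^sup>2" for n y
    using mult_mono[OF tr_bounds(3,2)[of n y]] tr_bounds(1)[of n y] by (simp add: power2_eq_square)
  have e_lim: "e \<longlonglongrightarrow> s"
    unfolding e_def s_def
  proof (rule integral_dominated_convergence[where w = "\<lambda>\<omega>. (U 0 \<omega>)\<^sup>2"])
    show "AE \<omega> in M. (\<lambda>n. tr n (U 0 \<omega>)) \<longlonglongrightarrow> (U 0 \<omega>)\<^sup>2"
    proof (rule AE_I2)
      fix \<omega>
      have "filterlim (\<lambda>n. real n powr w) at_top sequentially"
        using \<open>0 < w\<close> by (intro filterlim_compose[OF real_powr_at_top filterlim_real_sequentially])
      then have "\<forall>\<^sub>F n in sequentially. \<bar>U 0 \<omega>\<bar> \<le> real n powr w"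
        by (simp add: filterlim_at_top)
      then show "(\<lambda>n. tr n (U 0 \<omega>)) \<longlonglongrightarrow> (U 0 \<omega>)\<^sup>2"
        by (intro tendsto_eventually, elim eventually_mono)
          (auto simp: tr_def min_def abs_le_square_iff[symmetric])
    qed
    show "AE \<omega> in M. norm (tr n (U 0 \<omega>)) \<le> (U 0 \<omega>)\<^sup>2" for n
      using tr_bounds by auto
  qed (use int2 in auto)
  define X where "X n \<omega> = (\<Sum>i<n. tr n (U i \<omega>)) / n - e n" for n \<omega>
  have int_tr2: "integrable M (\<lambda>\<omega>. (tr n (U i \<omega>))\<^sup>2)" for n i
    by (rule Bochner_Integration.integrable_bound[of _ "\<lambda>\<omega>. (real n powr w)\<^sup>2 * (U i \<omega>)\<^sup>2"])
      (use int2 tr_sq in auto)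
  have second: "expectation (\<lambda>\<omega>. (tr n (U i \<omega>))\<^sup>2) \<le> (real n powr w)\<^sup>2 * s" for n i
  proof -
    have "expectation (\<lambda>\<omega>. (tr n (U i \<omega>))\<^sup>2) \<le> expectation (\<lambda>\<omega>. (real n powr w)\<^sup>2 * (U i \<omega>)\<^sup>2)"
      using int_tr2 int2 tr_sq by (intro integral_mono) auto
    also have "\<dots> = (real n powr w)\<^sup>2 * s"
      unfolding s_def using same[of "\<lambda>y. y\<^sup>2" i] by simp
    finally show ?thesis .
  qed
  have eqn: "expectation (\<lambda>\<omega>. tr n (U i \<omega>)) = e n" for n i
    unfolding e_def by (rule same) simp
  have sm: "integrable M (\<lambda>\<omega>. (X n \<omega>)\<^sup>2)"
      "expectation (\<lambda>\<omega>. (X n \<omega>)\<^sup>2) \<le> (real n powr w)\<^sup>2 * s / n" if "n > 0" for n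
    using sample_mean_second_moment[OF indep_vars_compose2[OF ind, of "\<lambda>_. tr n" "\<lambda>_. borel"]
      int_tr2 eqn second that] that by (simp_all add: X_def)
  have int: "integrable M (\<lambda>\<omega>. (X n \<omega>)\<^sup>2)" for n
    using sm(1)[of n] by (cases "n = 0") (simp_all add: X_def)
  have "(\<lambda>n. expectation (\<lambda>\<omega>. (X n \<omega>)\<^sup>2)) \<longlonglongrightarrow> 0"
  proof (rule tendsto_sandwich[of "\<lambda>_. 0"])
    show "\<forall>\<^sub>F n in sequentially. expectation (\<lambda>\<omega>. (X n \<omega>)\<^sup>2) \<le> s * real n powr (2 * w - 1)"
      using eventually_gt_at_top[of 0]
    proof eventually_elim
      case (elim n)
      have "(real n powr w)\<^sup>2 * s / n = s * real n powr (2 * w - 1)"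
        using elim by (simp add: powr_diff power2_eq_square flip: powr_add)
      then show ?case using sm(2)[OF elim] by simp
    qed
    have "(\<lambda>n. real n powr (2 * w - 1)) \<longlonglongrightarrow> 0"
      using \<open>w < 1 / 2\<close> by (intro tendsto_neg_powr filterlim_real_sequentially) auto
    then show "(\<lambda>n. s * real n powr (2 * w - 1)) \<longlonglongrightarrow> 0"
      by (rule tendsto_mult_right_zero)
  qed auto
  then have "((\<lambda>x. X (fst x) (snd x)) \<longlongrightarrow> 0) (off_vanishing_events M)"
    using int by (intro tendsto_off_vanishing_events_if_second_moment) (auto simp: X_def[abs_def])
  from tendsto_add[OF this tendsto_fst_off_vanishing_events[OF e_lim]]
  have "((\<lambda>x. X (fst x) (snd x) + e (fst x)) \<longlongrightarrow> s) (off_vanishing_events M)" by simp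
  moreover have "\<forall>\<^sub>F x in off_vanishing_events M.
      X (fst x) (snd x) + e (fst x) = (\<Sum>i<fst x. (U i (snd x))\<^sup>2) / fst x"
    using max eventually_fst_off_vanishing_events[OF eventually_gt_at_top[of 0]]
  proof eventually_elim
    case (elim x)
    have "tr (fst x) (U i (snd x)) = (U i (snd x))\<^sup>2" if "i < fst x" for i
      using elim(1) that by (auto simp: tr_def min_def abs_le_square_iff[symmetric])
    then show ?case using elim(2) by (simp add: X_def)
  qed
  ultimately show ?thesis
    unfolding s_def by (rule Lim_transform_eventually)
qed

end

section \<open>Asymptotics of the empirical likelihood ratio\<close>

text \<open>The two quadratic bounds combined along an arbitrary filter. The parameter \<open>d\<close> of these bounds is
fixed first; the quotient is then eventually between two quantities with the limits \<open>2 - 1 / (1 - d)\<close> and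
\<open>1 / (1 - d)\<close>, and both are as close to \<open>1\<close> as desired for small \<open>d\<close>.\<close>

lemma EL_ratio_asymptotics:
  fixes F :: "'x filter" and N :: "'x \<Rightarrow> nat" and u :: "'x \<Rightarrow> nat \<Rightarrow> real"
    and m \<delta> :: "'x \<Rightarrow> real" and v :: real
  defines "ub \<equiv> \<lambda>x. (\<Sum>i<N x. u x i) / N x"
  assumes "v > 0"
    and N: "\<forall>\<^sub>F x in F. N x > 0" and \<delta>: "\<forall>\<^sub>F x in F. \<delta> x \<noteq> 0"
    and mean: "((\<lambda>x. (ub x - m x) / \<delta> x) \<longlongrightarrow> -1) F"
    and to_m: "((\<lambda>x. ub x - m x) \<longlongrightarrow> 0) F"
    and var: "((\<lambda>x. (\<Sum>i<N x. (u x i)\<^sup>2) / N x - (ub x)\<^sup>2) \<longlongrightarrow> v) F"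
    and small_m: "\<And>d. d > 0 \<Longrightarrow> \<forall>\<^sub>F x in F. \<forall>i<N x. \<bar>(ub x - m x) * (u x i - m x)\<bar> \<le> d"
    and small_ub: "\<And>d. d > 0 \<Longrightarrow> \<forall>\<^sub>F x in F. \<forall>i<N x. \<bar>(ub x - m x) * (u x i - ub x)\<bar> \<le> d"
  shows "((\<lambda>x. EL_ratio (N x) (u x) (m x) / ereal (N x * (\<delta> x)\<^sup>2 / v)) \<longlongrightarrow> ereal 1) F"
proof -
  define xb where "xb x = (\<Sum>i<N x. u x i - m x) / N x" for x
  define q where "q x = (\<Sum>i<N x. (u x i - m x)\<^sup>2) / N x" for x
  define s where "s x = (\<Sum>i<N x. (u x i)\<^sup>2) / N x - (ub x)\<^sup>2" for x
  have xb: "\<forall>\<^sub>F x in F. xb x = ub x - m x"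
    using N by eventually_elim (simp add: xb_def ub_def sum_subtractf diff_divide_distrib)
  have q: "\<forall>\<^sub>F x in F. s x + (ub x - m x)\<^sup>2 = q x"
    using N
  proof eventually_elim
    case (elim x)
    have "q x = ((\<Sum>i<N x. (u x i)\<^sup>2) - 2 * m x * (\<Sum>i<N x. u x i) + N x * (m x)\<^sup>2) / N x"
      unfolding q_def
      by (simp add: power2_diff sum_subtractf sum.distrib sum_distrib_left algebra_simps)
    then show ?case
      using elim by (simp add: s_def ub_def power2_diff add_divide_distrib diff_divide_distrib)
  qed
  have s_lim: "(s \<longlongrightarrow> v) F" using var by (simp add: s_def[abs_def])
  have "((\<lambda>x. s x + (ub x - m x)\<^sup>2) \<longlongrightarrow> v + 0\<^sup>2) F"
    by (intro tendsto_intros s_lim to_m)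
  then have q_lim: "(q \<longlongrightarrow> v) F"
    using Lim_transform_eventually[OF _ q] by simp
  have sq_lim: "((\<lambda>x. ((ub x - m x) / \<delta> x)\<^sup>2 * v / q x) \<longlongrightarrow> 1) F"
      "((\<lambda>x. ((ub x - m x) / \<delta> x)\<^sup>2 * v / s x) \<longlongrightarrow> 1) F"
  proof -
    have "((\<lambda>x. ((ub x - m x) / \<delta> x)\<^sup>2 * v / q x) \<longlongrightarrow> (-1)\<^sup>2 * v / v) F"
      "((\<lambda>x. ((ub x - m x) / \<delta> x)\<^sup>2 * v / s x) \<longlongrightarrow> (-1)\<^sup>2 * v / v) F"
      using \<open>v > 0\<close> by (intro tendsto_intros mean q_lim s_lim; simp)+
    then show "((\<lambda>x. ((ub x - m x) / \<delta> x)\<^sup>2 * v / q x) \<longlongrightarrow> 1) F"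
      "((\<lambda>x. ((ub x - m x) / \<delta> x)\<^sup>2 * v / s x) \<longlongrightarrow> 1) F"
      using \<open>v > 0\<close> by simp_all
  qed
  have lower: "\<forall>\<^sub>F x in F. ereal (((ub x - m x) / \<delta> x)\<^sup>2 * v / q x * (2 - 1 / (1 - d)))
      \<le> EL_ratio (N x) (u x) (m x) / ereal (N x * (\<delta> x)\<^sup>2 / v)" if "0 < d" "d < 1" for d
  proof -
    \<comment> \<open>The dual bound allows sizes up to \<open>d * q x\<close>, which vary with \<open>x\<close>; the
      constant \<open>d * (v / 2)\<close> is eventually below them.\<close>
    have "\<forall>\<^sub>F x in F. v / 2 < q x"
      using \<open>v > 0\<close> by (intro order_tendstoD(1)[OF q_lim]) simp
    moreover have "\<forall>\<^sub>F x in F. \<forall>i<N x. \<bar>(ub x - m x) * (u x i - m x)\<bar> \<le> d * (v / 2)"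
      using \<open>v > 0\<close> \<open>0 < d\<close> by (intro small_m) simp
    ultimately show ?thesis
      using N \<delta> xb
    proof eventually_elim
      case (elim x)
      define c where "c = N x * (\<delta> x)\<^sup>2 / v"
      have pos: "0 < q x" "0 < c"
        using elim \<open>v > 0\<close> by (auto simp: c_def)
      have "ereal (N x * (xb x)\<^sup>2 / q x * (2 - 1 / (1 - d))) \<le> EL_ratio (N x) (u x) (m x)"
        unfolding xb_def q_def
      proof (rule EL_ratio_ge_quadratic)
        fix i assume "i < N x"
        then have "\<bar>xb x * (u x i - m x)\<bar> \<le> d * (v / 2)" using elim by simp
        also have "\<dots> \<le> d * q x" using elim \<open>0 < d\<close> by simp
        finally show "\<bar>(\<Sum>i<N x. u x i - m x) / N x * (u x i - m x)\<bar> \<le> d * ((\<Sum>i<N x. (u x i - m x)\<^sup>2) / N x)"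
          by (simp add: xb_def q_def)
      qed (use elim pos that in \<open>auto simp: q_def\<close>)
      from ereal_divide_right_mono[OF this, of "ereal c"]
      have "ereal (N x * (xb x)\<^sup>2 / q x * (2 - 1 / (1 - d)) / c)
          \<le> EL_ratio (N x) (u x) (m x) / ereal c"
        using pos by simp
      also have "N x * (xb x)\<^sup>2 / q x * (2 - 1 / (1 - d)) / c
          = ((ub x - m x) / \<delta> x)\<^sup>2 * v / q x * (2 - 1 / (1 - d))"
        using elim by (simp add: power_divide c_def mult_ac)
      finally show ?case by (simp only: c_def)
    qed
  qed
  have upper: "\<forall>\<^sub>F x in F. EL_ratio (N x) (u x) (m x) / ereal (N x * (\<delta> x)\<^sup>2 / v)
      \<le> ereal (((ub x - m x) / \<delta> x)\<^sup>2 * v / s x * (1 / (1 - d)))" if "0 < d" "d < 1" for d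
  proof -
    have "\<forall>\<^sub>F x in F. v / 2 < s x"
      using \<open>v > 0\<close> by (intro order_tendstoD(1)[OF s_lim]) simp
    moreover have "\<forall>\<^sub>F x in F. \<forall>i<N x. \<bar>(ub x - m x) * (u x i - ub x)\<bar> \<le> d * (v / 2)"
      using \<open>v > 0\<close> \<open>0 < d\<close> by (intro small_ub) simp
    ultimately show ?thesis
      using N \<delta>
    proof eventually_elim
      case (elim x)
      define c where "c = N x * (\<delta> x)\<^sup>2 / v"
      have pos: "0 < s x" "0 < c"
        using elim \<open>v > 0\<close> by (auto simp: c_def)
      have "EL_ratio (N x) (u x) (m x) \<le> ereal (N x * (ub x - m x)\<^sup>2 / s x / (1 - d))"
        unfolding s_def ub_def
      proof (rule EL_ratio_le_quadratic)
        fix i assume "i < N x"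
        then have "\<bar>(ub x - m x) * (u x i - ub x)\<bar> \<le> d * (v / 2)" using elim by simp
        also have "\<dots> \<le> d * s x" using elim \<open>0 < d\<close> by simp
        finally show "\<bar>((\<Sum>i<N x. u x i) / N x - m x) * (u x i - (\<Sum>i<N x. u x i) / N x)\<bar>
          \<le> d * ((\<Sum>i<N x. (u x i)\<^sup>2) / N x - ((\<Sum>i<N x. u x i) / N x)\<^sup>2)"
          by (simp add: ub_def s_def)
      qed (use elim pos that in \<open>auto simp: s_def ub_def\<close>)
      from ereal_divide_right_mono[OF this, of "ereal c"]
      have "EL_ratio (N x) (u x) (m x) / ereal c
          \<le> ereal (N x * (ub x - m x)\<^sup>2 / s x / (1 - d) / c)"
        using pos by simp
      also have "N x * (ub x - m x)\<^sup>2 / s x / (1 - d) / c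
          = ((ub x - m x) / \<delta> x)\<^sup>2 * v / s x * (1 / (1 - d))"
        using elim by (simp add: power_divide c_def mult_ac)
      finally show ?case by (simp only: c_def)
    qed
  qed
  have lim_at_0: "((\<lambda>d::real. 2 - 1 / (1 - d)) \<longlongrightarrow> 1) (at_right 0)"
      "((\<lambda>d::real. 1 / (1 - d)) \<longlongrightarrow> 1) (at_right 0)"
    by (auto intro!: tendsto_eq_intros)
  have small_d: "\<forall>\<^sub>F d in at_right 0. 0 < d \<and> d < (1::real)"
    using eventually_at_right_real[of 0 1] by simp
  show ?thesis
  proof (rule order_tendstoI)
    fix y assume "y < ereal 1"
    then obtain r where r: "y < ereal r" "r < 1" using ereal_dense2 by force
    obtain d where d: "r < 2 - 1 / (1 - d)" "0 < d" "d < 1"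
      using eventually_happens[OF eventually_conj[OF order_tendstoD(1)[OF lim_at_0(1) \<open>r < 1\<close>] small_d]]
      by auto
    have "((\<lambda>x. ((ub x - m x) / \<delta> x)\<^sup>2 * v / q x * (2 - 1 / (1 - d))) \<longlongrightarrow> 1 * (2 - 1 / (1 - d))) F"
      by (intro tendsto_mult sq_lim tendsto_const)
    then have "\<forall>\<^sub>F x in F. r < ((ub x - m x) / \<delta> x)\<^sup>2 * v / q x * (2 - 1 / (1 - d))"
      using d by (intro order_tendstoD(1)) auto
    then show "\<forall>\<^sub>F x in F. y < EL_ratio (N x) (u x) (m x) / ereal (N x * (\<delta> x)\<^sup>2 / v)"
      using lower[OF d(2,3)]
    proof eventually_elim
      case (elim x)
      note r(1)
      also have "ereal r \<le> ereal (((ub x - m x) / \<delta> x)\<^sup>2 * v / q x * (2 - 1 / (1 - d)))"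
        using elim(1) by simp
      also note elim(2)
      finally show ?case .
    qed
  next
    fix y assume "ereal 1 < y"
    then obtain r where r: "ereal r < y" "1 < r" using ereal_dense2 by force
    obtain d where d: "1 / (1 - d) < r" "0 < d" "d < 1"
      using eventually_happens[OF eventually_conj[OF order_tendstoD(2)[OF lim_at_0(2) \<open>1 < r\<close>] small_d]]
      by auto
    have "((\<lambda>x. ((ub x - m x) / \<delta> x)\<^sup>2 * v / s x * (1 / (1 - d))) \<longlongrightarrow> 1 * (1 / (1 - d))) F"
      by (intro tendsto_mult sq_lim tendsto_const)
    then have "\<forall>\<^sub>F x in F. ((ub x - m x) / \<delta> x)\<^sup>2 * v / s x * (1 / (1 - d)) < r"
      using d by (intro order_tendstoD(2)) auto
    then show "\<forall>\<^sub>F x in F. EL_ratio (N x) (u x) (m x) / ereal (N x * (\<delta> x)\<^sup>2 / v) < y"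
      using upper[OF d(2,3)]
    proof eventually_elim
      case (elim x)
      note elim(2)
      also have "ereal (((ub x - m x) / \<delta> x)\<^sup>2 * v / s x * (1 / (1 - d))) \<le> ereal r"
        using elim(1) by simp
      also note r(1)
      finally show ?case .
    qed
  qed
qed

theorem proposition1:
  fixes M :: "'a measure"
    and U :: "nat \<Rightarrow> 'a \<Rightarrow> real"
    and \<nu> w \<mu>\<^sub>0 \<sigma>2 :: real
    and \<mu> :: "nat \<Rightarrow> real"
  assumes "prob_space M"
    and "prob_space.indep_vars M (\<lambda>_. borel) U UNIV"
    and "\<And>i j. distr M borel (U i) = distr M borel (U j)"
    and "\<nu> \<ge> 3"
    and "\<And>i. integrable M (\<lambda>\<omega>. \<bar>U i \<omega>\<bar> powr \<nu>)"
    and "\<And>i. \<mu>\<^sub>0 = prob_space.expectation M (U i)"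
    and "\<And>i. \<sigma>2 = prob_space.expectation M (\<lambda>\<omega>. (U i \<omega> - \<mu>\<^sub>0)\<^sup>2)"
    and "\<sigma>2 > 0"
    and "1 / \<nu> < w" and "w < 1 / 2"
    and "\<exists>a b. 0 < a \<and> a \<le> b \<and>
           (\<forall>\<^sub>F n in sequentially.
              a * real n powr (- w) \<le> \<bar>\<mu> n - \<mu>\<^sub>0\<bar> \<and> \<bar>\<mu> n - \<mu>\<^sub>0\<bar> \<le> b * real n powr (- w))"
  shows "tendsto_in_prob M
           (\<lambda>n \<omega>. EL_ratio n (\<lambda>i. U i \<omega>) (\<mu> n) / ereal (real n * (\<mu> n - \<mu>\<^sub>0)\<^sup>2 / \<sigma>2)) 1"
proof -
  interpret prob_space M by fact
  have [measurable]: "U i \<in> borel_measurable M" for i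
    using assms(2) by (auto simp: indep_vars_def)
  have "\<nu> > 0" using \<open>\<nu> \<ge> 3\<close> by simp
  then have "w > 0" using \<open>1 / \<nu> < w\<close> by (meson divide_pos_pos less_trans zero_less_one)
  have same: "expectation (\<lambda>\<omega>. g (U i \<omega>)) = expectation (\<lambda>\<omega>. g (U 0 \<omega>))"
    if [measurable]: "g \<in> borel_measurable borel" for g :: "real \<Rightarrow> real" and i
    using assms(3)[of i 0] by (simp flip: integral_distr[OF _ that, of "U _"])
  have int2: "integrable M (\<lambda>\<omega>. (U i \<omega>)\<^sup>2)" for i
  proof (rule Bochner_Integration.integrable_bound)
    show "integrable M (\<lambda>\<omega>. 1 + \<bar>U i \<omega>\<bar> powr \<nu>)" using assms(5) by simp
    show "AE \<omega> in M. norm ((U i \<omega>)\<^sup>2) \<le> norm (1 + \<bar>U i \<omega>\<bar> powr \<nu>)"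
    proof (rule AE_I2)
      fix \<omega>
      show "norm ((U i \<omega>)\<^sup>2) \<le> norm (1 + \<bar>U i \<omega>\<bar> powr \<nu>)"
      proof (cases "\<bar>U i \<omega>\<bar> \<le> 1")
        case True
        then have "(U i \<omega>)\<^sup>2 \<le> 1" by (simp add: abs_square_le_1)
        then show ?thesis by (simp add: add_increasing2)
      next
        case False
        then have "\<bar>U i \<omega>\<bar> powr 2 \<le> \<bar>U i \<omega>\<bar> powr \<nu>"
          using \<open>\<nu> \<ge> 3\<close> by (intro powr_mono) auto
        then show ?thesis using False by simp
      qed
    qed
  qed simp
  have int: "integrable M (U i)" for i
    using int2[of i] by (rule square_integrable_imp_integrable[rotated]) simp
  define s where "s = expectation (\<lambda>\<omega>. (U 0 \<omega>)\<^sup>2)"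
  have second: "expectation (\<lambda>\<omega>. (U i \<omega>)\<^sup>2) = s" for i
    unfolding s_def by (rule same) simp
  have mean: "expectation (U i) = \<mu>\<^sub>0" for i
    using assms(6) by simp
  have \<sigma>2: "\<sigma>2 = s - \<mu>\<^sub>0\<^sup>2"
    using variance_eq[OF int int2, of 0] mean second assms(7)[of 0] by simp

  let ?F = "off_vanishing_events M"
  define A where "A x = (\<Sum>i<fst x. U i (snd x)) / fst x" for x :: "nat \<times> 'a"
  define \<delta> where "\<delta> n = \<mu> n - \<mu>\<^sub>0" for n
  obtain a b where "0 < a" "a \<le> b" and
    order: "\<forall>\<^sub>F n in sequentially. a * real n powr (- w) \<le> \<bar>\<delta> n\<bar> \<and> \<bar>\<delta> n\<bar> \<le> b * real n powr (- w)"
    using assms(11) unfolding \<delta>_def by blast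
  note order_F = eventually_fst_off_vanishing_events[OF order]
  have pos_F: "\<forall>\<^sub>F x in ?F. 0 < fst x"
    by (rule eventually_fst_off_vanishing_events) (rule eventually_gt_at_top)
  have decay: "(\<lambda>n. real n powr (- w)) \<longlonglongrightarrow> 0"
    using \<open>w > 0\<close> by (intro tendsto_neg_powr filterlim_real_sequentially) auto
  have max: "\<forall>\<^sub>F x in ?F. \<forall>i<fst x. \<bar>U i (snd x)\<bar> \<le> \<eta> * real (fst x) powr w" if "\<eta> > 0" for \<eta>
    by (rule sample_abs_le_power_off_vanishing_events[OF _ assms(5) same[of "\<lambda>y. \<bar>y\<bar> powr \<nu>"]])
      (use \<open>\<nu> > 0\<close> assms(9) that in auto)
  have rate: "((\<lambda>x. real (fst x) powr w * (A x - \<mu>\<^sub>0)) \<longlongrightarrow> 0) ?F"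
    unfolding A_def
    by (rule sample_mean_rate_off_vanishing_events[OF assms(2) int2 mean second assms(10)])
  have second_lim: "((\<lambda>x. (\<Sum>i<fst x. (U i (snd x))\<^sup>2) / fst x) \<longlongrightarrow> s) ?F"
    unfolding s_def
    by (rule sample_second_moment_off_vanishing_events[OF assms(2,3) int2 _ \<open>w > 0\<close> assms(10)])
      (use max[of 1] in simp)

  have \<delta>_lim: "((\<lambda>x. \<delta> (fst x)) \<longlongrightarrow> 0) ?F"
  proof (rule tendsto_fst_off_vanishing_events, rule tendsto_rabs_zero_cancel,
      rule tendsto_sandwich[of "\<lambda>_. 0"])
    show "\<forall>\<^sub>F n in sequentially. \<bar>\<delta> n\<bar> \<le> b * real n powr (- w)"
      using order by eventually_elim simp
    show "(\<lambda>n. b * real n powr (- w)) \<longlonglongrightarrow> 0"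
      using decay by (rule tendsto_mult_right_zero)
  qed (auto intro: tendsto_const)
  have \<delta>_nz: "\<forall>\<^sub>F x in ?F. \<delta> (fst x) \<noteq> 0"
    using order_F pos_F
  proof eventually_elim
    case (elim x)
    then have "0 < a * real (fst x) powr (- w)" using \<open>0 < a\<close> by simp
    then show ?case using elim by linarith
  qed
  have ratio_lim: "((\<lambda>x. (A x - \<mu>\<^sub>0) / \<delta> (fst x)) \<longlongrightarrow> 0) ?F"
  proof (rule Lim_null_comparison)
    show "\<forall>\<^sub>F x in ?F. norm ((A x - \<mu>\<^sub>0) / \<delta> (fst x)) \<le> \<bar>real (fst x) powr w * (A x - \<mu>\<^sub>0)\<bar> / a"
      using order_F pos_F
    proof eventually_elim
      case (elim x)
      have pos: "0 < a * real (fst x) powr (- w)" using elim \<open>0 < a\<close> by simp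
      have "norm ((A x - \<mu>\<^sub>0) / \<delta> (fst x)) \<le> \<bar>A x - \<mu>\<^sub>0\<bar> / (a * real (fst x) powr (- w))"
        using elim pos by (auto simp: abs_divide intro!: divide_left_mono mult_pos_pos)
      also have "\<dots> = \<bar>real (fst x) powr w * (A x - \<mu>\<^sub>0)\<bar> / a"
        by (simp add: powr_minus_divide abs_mult mult.commute)
      finally show ?case .
    qed
    show "((\<lambda>x. \<bar>real (fst x) powr w * (A x - \<mu>\<^sub>0)\<bar> / a) \<longlongrightarrow> 0) ?F"
      using tendsto_divide[OF tendsto_rabs[OF rate] tendsto_const[of a]] \<open>0 < a\<close> by simp
  qed
  have xb_ratio: "((\<lambda>x. (A x - \<mu> (fst x)) / \<delta> (fst x)) \<longlongrightarrow> -1) ?F"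
  proof (rule Lim_transform_eventually)
    show "((\<lambda>x. (A x - \<mu>\<^sub>0) / \<delta> (fst x) - 1) \<longlongrightarrow> -1) ?F"
      using tendsto_diff[OF ratio_lim tendsto_const[of 1]] by simp
    show "\<forall>\<^sub>F x in ?F. (A x - \<mu>\<^sub>0) / \<delta> (fst x) - 1 = (A x - \<mu> (fst x)) / \<delta> (fst x)"
      using \<delta>_nz by eventually_elim (simp add: \<delta>_def field_simps)
  qed
  have xb_lim: "((\<lambda>x. A x - \<mu> (fst x)) \<longlongrightarrow> 0) ?F"
  proof (rule Lim_transform_eventually)
    show "((\<lambda>x. (A x - \<mu> (fst x)) / \<delta> (fst x) * \<delta> (fst x)) \<longlongrightarrow> 0) ?F"
      using tendsto_mult[OF xb_ratio \<delta>_lim] by simp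
  qed (use \<delta>_nz in \<open>eventually_elim, simp\<close>)
  have \<mu>_lim: "((\<lambda>x. \<mu> (fst x)) \<longlongrightarrow> \<mu>\<^sub>0) ?F"
    using tendsto_add[OF \<delta>_lim tendsto_const[of \<mu>\<^sub>0]] by (simp add: \<delta>_def)
  have A_lim: "(A \<longlongrightarrow> \<mu>\<^sub>0) ?F"
    using tendsto_add[OF xb_lim \<mu>_lim] by simp
  have var_lim: "((\<lambda>x. (\<Sum>i<fst x. (U i (snd x))\<^sup>2) / fst x - (A x)\<^sup>2) \<longlongrightarrow> \<sigma>2) ?F"
    unfolding \<sigma>2 by (intro tendsto_intros second_lim A_lim)

  have small: "\<forall>\<^sub>F x in ?F. \<forall>i<fst x. \<bar>(A x - \<mu> (fst x)) * (U i (snd x) - c x)\<bar> \<le> d"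
    if "0 < d" and c: "(c \<longlongrightarrow> \<mu>\<^sub>0) ?F" for c d
  proof -
    have "b > 0" using \<open>0 < a\<close> \<open>a \<le> b\<close> by simp
    \<comment> \<open>The factor \<open>A x - \<mu> (fst x)\<close> is at most \<open>2 * b * n powr -w\<close> in absolute value, so \<open>d / (4 * b)\<close> is the
      multiple of \<open>n powr w\<close> that contributes exactly \<open>d / 2\<close>.\<close>
    have "\<forall>\<^sub>F x in ?F. \<bar>(A x - \<mu> (fst x)) / \<delta> (fst x)\<bar> < 2"
      using tendsto_rabs[OF xb_ratio] by (rule order_tendstoD) simp
    moreover have "((\<lambda>x. (2 * b * real (fst x) powr (- w)) * \<bar>c x\<bar>) \<longlongrightarrow> 2 * b * 0 * \<bar>\<mu>\<^sub>0\<bar>) ?F"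
      by (intro tendsto_intros c tendsto_fst_off_vanishing_events decay)
    then have "\<forall>\<^sub>F x in ?F. (2 * b * real (fst x) powr (- w)) * \<bar>c x\<bar> < d / 2"
      using \<open>0 < d\<close> by (intro order_tendstoD(2)) auto
    moreover have "\<forall>\<^sub>F x in ?F. \<forall>i<fst x. \<bar>U i (snd x)\<bar> \<le> d / (4 * b) * real (fst x) powr w"
      using \<open>0 < d\<close> \<open>b > 0\<close> by (intro max) simp
    ultimately show ?thesis
      using order_F pos_F \<delta>_nz
    proof eventually_elim
      case (elim x)
      define h where "h = 2 * b * real (fst x) powr (- w)"
      have "h \<ge> 0" using \<open>b > 0\<close> by (simp add: h_def)
      have "\<bar>A x - \<mu> (fst x)\<bar> \<le> 2 * \<bar>\<delta> (fst x)\<bar>"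
        using elim by (simp add: abs_divide field_simps)
      also have "\<dots> \<le> h" using elim by (simp add: h_def)
      finally have xb: "\<bar>A x - \<mu> (fst x)\<bar> \<le> h" .
      show ?case
      proof (intro allI impI)
        fix i assume "i < fst x"
        then have "\<bar>U i (snd x) - c x\<bar> \<le> d / (4 * b) * real (fst x) powr w + \<bar>c x\<bar>"
          using elim(3) by (auto intro: order_trans[OF abs_triangle_ineq4])
        with xb have "\<bar>(A x - \<mu> (fst x)) * (U i (snd x) - c x)\<bar>
            \<le> h * (d / (4 * b) * real (fst x) powr w + \<bar>c x\<bar>)"
          unfolding abs_mult using \<open>h \<ge> 0\<close> by (intro mult_mono) auto
        also have "\<dots> = d / 2 + h * \<bar>c x\<bar>"
          using \<open>b > 0\<close> elim by (simp add: h_def powr_minus field_simps)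
        also have "\<dots> \<le> d" using elim(2) by (simp add: h_def)
        finally show "\<bar>(A x - \<mu> (fst x)) * (U i (snd x) - c x)\<bar> \<le> d" .
      qed
    qed
  qed
  have "((\<lambda>x. EL_ratio (fst x) (\<lambda>i. U i (snd x)) (\<mu> (fst x)) / ereal (fst x * (\<delta> (fst x))\<^sup>2 / \<sigma>2)) \<longlongrightarrow> ereal 1) ?F"
    by (rule EL_ratio_asymptotics[OF \<open>\<sigma>2 > 0\<close> pos_F \<delta>_nz])
      (use xb_ratio xb_lim var_lim small[OF _ \<mu>_lim] small[OF _ A_lim] in \<open>simp_all add: A_def\<close>)
  then show ?thesis
    unfolding \<delta>_def
    by (intro tendsto_in_prob_if_tendsto_off_vanishing_events borel_measurable_ereal_divide
        borel_measurable_EL_ratio borel_measurable_const) simp_all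
qed

end
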